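(* All positive integers except $1,2,4,6,8,12$ and $16$ are magic constants. That is, a positive integer $k$ is a magic constant if and only if $k \notin \{1,2,4,6,8,12,16\}$.
   Context: All graphs $G=(V,E)$ are finite, simple (undirected, no loops or multiple edges), with nonempty vertex set, and not necessarily connected. A positive integer $k$ is called a magic constant if there exist a graph $G=(V,E)$ and a bijection $f: V \to \{1,2,\dots,|V|\}$ such that for every vertex $v \in V$ the weight $w(v) = \sum_{u \in N(v)} f(u)$ equals $k$, where $N(v) = \{u \in V : uv \in E\}$ is the (open) neighborhood of $v$. *)

theory Defs
  imports "Graph_Theory.Pair_Digraph"
begin

text \<open>
  A simple graph is a \<open>pair_graph\<close>: a finite, loop-free digraph without parallel arcs whose arc
  set is symmetric, so that an undirected edge \<open>uv\<close> is the pair of arcs \<open>(u, v)\<close> and \<open>(v, u)\<close>.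
\<close>

definition neighborhood :: "'a pair_pre_digraph \<Rightarrow> 'a \<Rightarrow> 'a set" where
  "neighborhood G v = {u \<in> pverts G. (u, v) \<in> parcs G}"

definition weight :: "'a pair_pre_digraph \<Rightarrow> ('a \<Rightarrow> nat) \<Rightarrow> 'a \<Rightarrow> nat" where
  "weight G f v = (\<Sum>u\<in>neighborhood G v. f u)"

definition magic_labelling :: "'a pair_pre_digraph \<Rightarrow> ('a \<Rightarrow> nat) \<Rightarrow> nat \<Rightarrow> bool" where
  "magic_labelling G f k \<longleftrightarrow>
     bij_betw f (pverts G) {1..card (pverts G)} \<and> (\<forall>v\<in>pverts G. weight G f v = k)"

text \<open>
  The quantification over graphs has to fix a vertex type. Taking \<open>nat\<close> loses no generality:
  see \<open>magic_constantI\<close> below.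
\<close>

definition magic_constant :: "nat \<Rightarrow> bool" where
  "magic_constant k \<longleftrightarrow> 0 < k \<and>
     (\<exists>(G :: nat pair_pre_digraph) f. pair_graph G \<and> pverts G \<noteq> {} \<and> magic_labelling G f k)"

lemma magic_constantI:
  fixes G :: "'a pair_pre_digraph"
  assumes "0 < k" "pair_graph G" "pverts G \<noteq> {}" "magic_labelling G f k"
  shows "magic_constant k"
proof -
  interpret pair_graph G by fact
  define H where "H = \<lparr>pverts = f ` pverts G, parcs = map_prod f f ` parcs G\<rparr>"
  have bij: "bij_betw f (pverts G) {1..card (pverts G)}"
    and wt: "\<And>v. v \<in> pverts G \<Longrightarrow> weight G f v = k"
    using assms(4) by (auto simp: magic_labelling_def)
  have inj: "inj_on f (pverts G)" and img: "f ` pverts G = {1..card (pverts G)}"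
    using bij by (auto simp: bij_betw_def)
  have H: "pverts H = f ` pverts G" "parcs H = map_prod f f ` parcs G"
    by (simp_all add: H_def)
  have "sym (parcs H)"
    unfolding H sym_def by (force dest: arcs_symmetric)
  moreover have "fst e \<noteq> snd e" if "e \<in> parcs H" for e
  proof -
    from that obtain x y where xy: "(x, y) \<in> parcs G" "e = (f x, f y)"
      by (auto simp: H)
    then show ?thesis
      using no_loops'[OF xy(1)] in_arcsD1[OF xy(1)] in_arcsD2[OF xy(1)] inj
      by (auto dest: inj_onD)
  qed
  ultimately have pg: "pair_graph H"
    using pair_finite_verts pair_finite_arcs
    by unfold_locales (auto simp: H symmetric_def dest: in_arcsD1 in_arcsD2)
  have nb: "neighborhood H (f v) = f ` neighborhood G v" if v: "v \<in> pverts G" for v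
  proof (intro equalityI subsetI)
    fix w assume "w \<in> neighborhood H (f v)"
    then obtain x y where xy: "(x, y) \<in> parcs G" "w = f x" "f v = f y"
      by (auto simp: neighborhood_def H)
    then have "y = v" using inj_onD[OF inj] v in_arcsD2 by metis
    with xy show "w \<in> f ` neighborhood G v"
      by (auto simp: neighborhood_def dest: in_arcsD1)
  next
    fix w assume "w \<in> f ` neighborhood G v"
    then show "w \<in> neighborhood H (f v)"
      by (auto simp: neighborhood_def H intro: rev_image_eqI)
  qed
  have "weight H id (f v) = k" if v: "v \<in> pverts G" for v
  proof -
    have "inj_on f (neighborhood G v)"
      by (rule inj_on_subset[OF inj]) (auto simp: neighborhood_def)
    then have "weight H id (f v) = weight G f v"
      unfolding weight_def nb[OF v] by (simp add: sum.reindex)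
    with wt[OF v] show ?thesis by simp
  qed
  then have "\<forall>w\<in>pverts H. weight H id w = k" by (simp add: H(1))
  moreover have "bij_betw id (pverts H) {1..card (pverts H)}"
    using img card_image[OF inj] by (simp add: H(1))
  ultimately have "magic_labelling H id k" by (simp add: magic_labelling_def)
  moreover have "pverts H \<noteq> {}" using assms(3) by (simp add: H)
  ultimately show ?thesis
    unfolding magic_constant_def using pg assms(1) by blast
qed

end

theory Submission
  imports Defs
begin

text \<open>
  Replacing each vertex \<open>i\<close> of a graph \<open>H\<close> by a set \<open>B i\<close> of twins, where the \<open>B i\<close> partition
  \<open>{1, \<dots>, n}\<close>, gives a magic labelling as soon as the bag sums \<open>\<Sum>(B i)\<close>, viewed as vertex weights of
  \<open>H\<close>, have constant neighbourhood sums. If \<open>N\<close> is odd, the pairs \<open>{i, N - i}\<close> all have sum \<open>N\<close>, and a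
  \<open>d\<close>-regular circulant \<open>H\<close> yields the constant \<open>d N\<close>; the degrees \<open>1, 2, 4\<close> settle all \<open>k\<close> that are not
  divisible by \<open>8\<close>, up to small cases. For \<open>k = 8 u\<close> the labels \<open>1, \<dots>, 2 u\<close> are split into bags of
  sums \<open>2 u\<close> and \<open>3 u\<close>: a fixed gadget on nine bags accounts for the label \<open>u\<close>, which has no partner in
  a pair of sum \<open>2 u\<close>, and the remaining pairs form a \<open>4\<close>-regular graph. Conversely,
  the label \<open>n\<close> lies in some neighbourhood, so \<open>n \<le> k\<close>, and for the exceptional \<open>k\<close> an exhaustive search
  over the finitely many possible graphs fails.
\<close>

section \<open>Blow-ups of regular graphs\<close>

text \<open>The vertex \<open>(i, x)\<close> carries the label \<open>x\<close>, and adjacency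
  depends only on bag indices, so the weight at \<open>(j, y)\<close> is the total of the bags
  adjacent to \<open>j\<close>.\<close>

lemma magic_blow_up:
  fixes B :: "'i \<Rightarrow> nat set" and R :: "'i \<Rightarrow> 'i \<Rightarrow> bool"
  assumes k: "0 < k" and I: "finite I" "I \<noteq> {}"
    and disj: "disjoint_family_on B I" and un: "(\<Union>i\<in>I. B i) = {1..n}"
    and sym: "\<And>i j. i \<in> I \<Longrightarrow> j \<in> I \<Longrightarrow> R i j \<Longrightarrow> R j i"
    and irrefl: "\<And>i. i \<in> I \<Longrightarrow> \<not> R i i"
    and wt: "\<And>j. j \<in> I \<Longrightarrow> (\<Sum>i | i \<in> I \<and> R i j. \<Sum>(B i)) = k"
  shows "magic_constant k"
proof -
  define V where "V = Sigma I B"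
  define G where "G = \<lparr>pverts = V, parcs = {(p, q). p \<in> V \<and> q \<in> V \<and> R (fst p) (fst q)}\<rparr>"
  have G: "pverts G = V" "parcs G = {(p, q). p \<in> V \<and> q \<in> V \<and> R (fst p) (fst q)}"
    by (simp_all add: G_def)
  have finB: "finite (B i)" if "i \<in> I" for i
    by (rule finite_subset[of _ "{1..n}"]) (use un that in auto)
  have finV: "finite V"
    unfolding V_def using I finB by blast
  have "finite (parcs G)"
    by (rule finite_subset[of _ "V \<times> V"]) (auto simp: G finV)
  moreover have "Relation.sym (parcs G)"
    unfolding G(2) by (rule symI) (use sym in \<open>auto simp: V_def\<close>)
  moreover have "fst a \<in> V \<and> snd a \<in> V \<and> fst a \<noteq> snd a" if "a \<in> parcs G" for a
    using that irrefl by (auto simp: G(2)) (auto simp: V_def)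
  ultimately have "pair_graph G"
    using finV by unfold_locales (simp_all add: G(1) symmetric_def)
  moreover have "bij_betw snd V {1..n}"
  proof (rule bij_betw_imageI)
    show "inj_on snd V"
      using disj by (auto simp: inj_on_def V_def disjoint_family_on_def)
    show "snd ` V = {1..n}" unfolding un[symmetric] V_def by force
  qed
  then have "bij_betw snd (pverts G) {1..card (pverts G)}"
    using bij_betw_same_card[of snd V "{1..n}"] by (simp add: G)
  moreover have "weight G snd (j, y) = k" if "(j, y) \<in> V" for j y
  proof -
    have j: "j \<in> I" using that by (simp add: V_def)
    have "neighborhood G (j, y) = Sigma {i. i \<in> I \<and> R i j} B"
      using that by (auto simp: neighborhood_def G V_def)
    then have "weight G snd (j, y) = (\<Sum>i | i \<in> I \<and> R i j. \<Sum>(B i))"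
      unfolding weight_def using I finB by (simp add: sum.Sigma case_prod_beta)
    with wt[OF j] show ?thesis by simp
  qed
  moreover have "V \<noteq> {}"
  proof
    assume "V = {}"
    then have "B i = {}" if "i \<in> I" for i using that by (auto simp: V_def)
    moreover obtain j where "j \<in> I" using I by blast
    ultimately show False using wt[of j] k by simp
  qed
  ultimately show ?thesis
    using k by (intro magic_constantI[of k G snd]) (auto simp: magic_labelling_def G)
qed

text \<open>The circulant on the residues modulo \<open>card I\<close> with difference set
  \<open>D\<close>: closure of \<open>D\<close> under negation makes it undirected, and
  \<open>0\<close> not in \<open>D\<close> rules out loops.\<close>

lemma regular_graph_exists:
  assumes "finite I" "D \<subseteq> {1..<int (card I)}" "\<And>d. d \<in> D \<Longrightarrow> int (card I) - d \<in> D"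
  obtains R where "\<And>i j. i \<in> I \<Longrightarrow> j \<in> I \<Longrightarrow> R i j \<Longrightarrow> R j i" "\<And>i. i \<in> I \<Longrightarrow> \<not> R i i"
    "\<And>j. j \<in> I \<Longrightarrow> card {i \<in> I. R i j} = card D"
proof -
  define p where "p = int (card I)"
  obtain e where e: "bij_betw e I {0..<card I}"
    using ex_bij_betw_finite_nat[OF assms(1)] by blast
  define R where "R i j \<longleftrightarrow> (int (e i) - int (e j)) mod p \<in> D" for i j
  have lt: "e i < card I" if "i \<in> I" for i
    using bij_betwE[OF e] that by auto
  show thesis
  proof (rule that[of R])
    fix i j assume ij: "i \<in> I" "j \<in> I" "R i j"
    let ?d = "int (e i) - int (e j)"
    have d: "?d mod p \<in> D" using ij by (simp add: R_def)
    then have "?d mod p \<noteq> 0" using assms(2) by fastforce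
    then have "(- ?d) mod p = p - ?d mod p" using zmod_zminus1_eq_if[of ?d p] by presburger
    then show "R j i" using assms(3)[OF d] by (simp add: R_def flip: p_def)
  next
    fix i show "\<not> R i i" using assms(2) by (auto simp: R_def)
  next
    fix j assume j: "j \<in> I"
    define c where "c i = (int (e i) - int (e j)) mod p" for i
    have p: "p > 0" using j assms(1) by (auto simp: p_def card_gt_0_iff)
    have inj: "inj_on c I"
    proof (rule inj_onI)
      fix x y assume xy: "x \<in> I" "y \<in> I" "c x = c y"
      then have "p dvd (int (e x) - int (e j)) - (int (e y) - int (e j))"
        unfolding c_def by (metis mod_eq_dvd_iff)
      then have "p dvd int (e x) - int (e y)" by simp
      then have "int (e x) - int (e y) = 0"
        using lt[OF xy(1)] lt[OF xy(2)] dvd_imp_le_int[of "int (e x) - int (e y)" p]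
        by (fastforce simp: p_def)
      then show "x = y" using e xy by (auto simp: bij_betw_def dest: inj_onD)
    qed
    have "c ` I = {0..<p}"
    proof (rule card_subset_eq)
      show "c ` I \<subseteq> {0..<p}" using p by (auto simp: c_def)
      show "card (c ` I) = card {0..<p}" using card_image[OF inj] by (simp add: p_def)
    qed simp
    then have "D \<subseteq> c ` I" using assms(2) by (fastforce simp: p_def)
    then have "c ` {i \<in> I. R i j} = D" by (auto simp: R_def c_def)
    then show "card {i \<in> I. R i j} = card D"
      using card_image[of c "{i \<in> I. R i j}"] inj_on_subset[OF inj, of "{i \<in> I. R i j}"] by auto
  qed
qed

text \<open>Half of the even number \<open>card I\<close> is its own negative, so this one
  difference gives a perfect matching.\<close>

lemma one_regular_graph_exists:
  assumes "finite I" "even (card I)" "I \<noteq> {}"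
  obtains R where "\<And>i j. i \<in> I \<Longrightarrow> j \<in> I \<Longrightarrow> R i j \<Longrightarrow> R j i" "\<And>i. i \<in> I \<Longrightarrow> \<not> R i i"
    "\<And>j. j \<in> I \<Longrightarrow> card {i \<in> I. R i j} = 1"
proof (rule regular_graph_exists[OF assms(1), of "{int (card I) div 2}"])
  have "card I \<noteq> 0" using assms by simp
  then show "{int (card I) div 2} \<subseteq> {1..<int (card I)}"
    using assms(2) by (auto elim!: evenE)
  show "\<And>d. d \<in> {int (card I) div 2} \<Longrightarrow> int (card I) - d \<in> {int (card I) div 2}"
    using assms(2) by (auto elim!: evenE)
qed (use that in auto)

text \<open>The differences are \<open>1, ..., e\<close> and their negatives, all distinct because
  \<open>2 * e < card I\<close>.\<close>

lemma even_regular_graph_exists: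
  assumes "finite I" "2 * e < card I"
  obtains R where "\<And>i j. i \<in> I \<Longrightarrow> j \<in> I \<Longrightarrow> R i j \<Longrightarrow> R j i" "\<And>i. i \<in> I \<Longrightarrow> \<not> R i i"
    "\<And>j. j \<in> I \<Longrightarrow> card {i \<in> I. R i j} = 2 * e"
proof -
  let ?p = "int (card I)" and ?A = "{1..int e}" and ?B = "{int (card I) - int e..<int (card I)}"
  have "?A \<inter> ?B = {}" using assms(2) by auto
  then have card: "card (?A \<union> ?B) = 2 * e" by (subst card_Un_disjoint) auto
  have "?A \<union> ?B \<subseteq> {1..<?p}" using assms(2) by auto
  moreover have "?p - d \<in> ?A \<union> ?B" if "d \<in> ?A \<union> ?B" for d using that assms(2) by auto
  ultimately show thesis
    using regular_graph_exists[OF assms(1), of "?A \<union> ?B" thesis] that unfolding card by blast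
qed

lemma magic_regular_blow_up:
  fixes B :: "'i \<Rightarrow> nat set"
  assumes "0 < d * s" "finite I" "I \<noteq> {}"
    and "disjoint_family_on B I" "(\<Union>i\<in>I. B i) = {1..n}" "\<And>i. i \<in> I \<Longrightarrow> \<Sum>(B i) = s"
    and "\<And>i j. i \<in> I \<Longrightarrow> j \<in> I \<Longrightarrow> R i j \<Longrightarrow> R j i" "\<And>i. i \<in> I \<Longrightarrow> \<not> R i i"
    and "\<And>j. j \<in> I \<Longrightarrow> card {i \<in> I. R i j} = d"
  shows "magic_constant (d * s)"
  using assms(1-5,7,8)
proof (rule magic_blow_up)
  fix j assume "j \<in> I"
  then show "(\<Sum>i | i \<in> I \<and> R i j. \<Sum>(B i)) = d * s"
    using assms(6,9) by simp
qed

section \<open>Bags of equal odd sum\<close>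

definition antipodal_pair :: "nat \<Rightarrow> nat \<Rightarrow> nat set" where
  "antipodal_pair N i = {i, N - i} - {0}"

text \<open>As \<open>2 * h + 1\<close> is odd, no label is its own partner. Deleting
  \<open>0\<close> turns the pair of index \<open>0\<close> into the singleton
  \<open>{2 * h + 1}\<close>, and \<open>a\<close> decides whether this bag is present.\<close>

lemma antipodal_pairs:
  fixes h a :: nat
  assumes "a \<le> 1" "0 < h"
  defines "B \<equiv> antipodal_pair (2 * h + 1)"
  shows "disjoint_family_on B {a..h}" "(\<Union>i\<in>{a..h}. B i) = {1..2 * h + 1 - a}"
    "i \<in> {a..h} \<Longrightarrow> \<Sum>(B i) = 2 * h + 1"
proof -
  show "disjoint_family_on B {a..h}"
    by (auto simp: disjoint_family_on_def B_def antipodal_pair_def)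
  show "(\<Union>i\<in>{a..h}. B i) = {1..2 * h + 1 - a}"
  proof (intro equalityI subsetI)
    fix x assume "x \<in> {1..2 * h + 1 - a}"
    then have "x \<in> B (min x (2 * h + 1 - x))" "min x (2 * h + 1 - x) \<in> {a..h}"
      using assms(1) by (auto simp: B_def antipodal_pair_def min_def)
    then show "x \<in> (\<Union>i\<in>{a..h}. B i)" by blast
  qed (use assms(1) in \<open>auto simp: B_def antipodal_pair_def\<close>)
  show "\<Sum>(B i) = 2 * h + 1" if "i \<in> {a..h}"
  proof (cases "i = 0")
    case False
    with that have "B i = {i, 2 * h + 1 - i}" "i \<noteq> 2 * h + 1 - i"
      by (auto simp: B_def antipodal_pair_def)
    with that show ?thesis by simp
  qed (simp add: B_def antipodal_pair_def insert_Diff_if)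
qed

lemma magic_odd:
  assumes "odd k" "3 \<le> k"
  shows "magic_constant k"
proof -
  obtain h where h: "k = 2 * h + 1" using assms(1) by (elim oddE)
  \<comment> \<open>There are \<open>h + 1 - a\<close> bags, and a perfect matching needs an even
    number of them.\<close>
  define a :: nat where "a = (if even h then 1 else 0)"
  have a: "a \<le> 1" "0 < h" "{a..h} \<noteq> {}" using h assms(2) by (auto simp: a_def)
  have "even (card {a..h})" by (simp add: a_def)
  then obtain R where R: "\<And>i j. i \<in> {a..h} \<Longrightarrow> j \<in> {a..h} \<Longrightarrow> R i j \<Longrightarrow> R j i"
      "\<And>i. i \<in> {a..h} \<Longrightarrow> \<not> R i i" "\<And>j. j \<in> {a..h} \<Longrightarrow> card {i \<in> {a..h}. R i j} = 1"
    using one_regular_graph_exists[of "{a..h}"] a(3) by blast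
  have "magic_constant (1 * (2 * h + 1))"
    by (rule magic_regular_blow_up[OF _ _ a(3) antipodal_pairs[OF a(1,2)] R])
      auto
  then show ?thesis by (simp add: h)
qed

text \<open>For \<open>N = 2 * h + 1\<close> there are \<open>h + 1\<close> bags;
  \<open>4 * e + 1 \<le> N\<close> says that this exceeds the degree \<open>2 * e\<close>.\<close>

lemma magic_even_times_odd:
  assumes "0 < e" "odd N" "4 * e + 1 \<le> N"
  shows "magic_constant (2 * e * N)"
proof -
  obtain h where h: "N = 2 * h + 1" using assms(2) by (elim oddE)
  have a: "(0::nat) \<le> 1" "0 < h" "{0..h} \<noteq> {}" using h assms by auto
  have "2 * e < card {0..h}" using h assms by simp
  then obtain R where R: "\<And>i j. i \<in> {0..h} \<Longrightarrow> j \<in> {0..h} \<Longrightarrow> R i j \<Longrightarrow> R j i"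
      "\<And>i. i \<in> {0..h} \<Longrightarrow> \<not> R i i" "\<And>j. j \<in> {0..h} \<Longrightarrow> card {i \<in> {0..h}. R i j} = 2 * e"
    using even_regular_graph_exists[of "{0..h}" e] by blast
  show ?thesis unfolding h
    by (rule magic_regular_blow_up[OF _ _ a(3) antipodal_pairs[OF a(1,2)] R])
      (use assms(1) in auto)
qed
section \<open>Multiples of eight\<close>

text \<open>Outside the gadget \<open>u - 11\<close> pairs remain; \<open>16 \<le> u\<close> makes
  these at least five, enough for a 4-regular graph.\<close>

lemma magic_eight_times:
  assumes u: "16 \<le> u"
  shows "magic_constant (8 * u)"
proof -
  obtain w where w: "u = w + 16" using u by (metis le_Suc_ex add.commute)
  define I where "I = {..<w + 14}"
  \<comment> \<open>The bags \<open>0, 1, 2, 3, 5\<close> have sum \<open>3 u\<close>. They use up \<open>u\<close> and the pairs \<open>{i, 2 u - i}\<close> with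
    \<open>i \<in> {0, 1, 2, 3, 5, u - 2, u - 1}\<close>; every other pair is the bag with index \<open>i\<close>.\<close>
  define B where "B i = (if i = 0 then {w + 16, 2 * w + 32} else if i = 1 then {1, w + 17, 2 * w + 30}
    else if i = 2 then {2, w + 15, 2 * w + 31} else if i = 3 then {3, w + 18, 2 * w + 27}
    else if i = 5 then {5, w + 14, 2 * w + 29} else {i, 2 * w + 32 - i})" for i :: nat
  \<comment> \<open>In units of \<open>u\<close>: the bags \<open>1, 2, 3, 5\<close> form a cycle
    with one light neighbour each (3 + 3 + 2), bag \<open>0\<close> sees the four light bags (4 *
    2), and each light bag sees \<open>0\<close>, one cycle bag and one light bag (3 + 3 +
    2).\<close>
  define E :: "(nat \<times> nat) set" where "E = {(1, 2), (2, 3), (3, 5), (5, 1), (1, 4), (2, 6), (3, 7), (5, 8),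
    (4, 6), (7, 8), (0, 4), (0, 6), (0, 7), (0, 8)}"
  have "2 * 2 < card {9..<w + 14}" using u by simp
  then obtain R' where R': "\<And>i j. i \<in> {9..<w + 14} \<Longrightarrow> j \<in> {9..<w + 14} \<Longrightarrow> R' i j \<Longrightarrow> R' j i"
      "\<And>i. i \<in> {9..<w + 14} \<Longrightarrow> \<not> R' i i" "\<And>j. j \<in> {9..<w + 14} \<Longrightarrow> card {i \<in> {9..<w + 14}. R' i j} = 2 * 2"
    using even_regular_graph_exists[of "{9..<w + 14}" 2] by blast
  define R where "R i j \<longleftrightarrow> (i, j) \<in> E \<or> (j, i) \<in> E \<or> 9 \<le> i \<and> 9 \<le> j \<and> R' i j" for i j
  have E9: "i < 9 \<and> j < 9" if "(i, j) \<in> E" for i j using that by (auto simp: E_def)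
  \<comment> \<open>Recovering the index from a label gives disjointness without comparing bags two
    by two.\<close>
  define bag where "bag x = (if x \<in> {w + 16, 2 * w + 32} then 0 else if x \<in> {1, w + 17, 2 * w + 30} then 1
    else if x \<in> {2, w + 15, 2 * w + 31} then 2 else if x \<in> {3, w + 18, 2 * w + 27} then 3
    else if x \<in> {5, w + 14, 2 * w + 29} then 5 else if x < w + 14 then x else 2 * w + 32 - x)" for x :: nat
  have bag: "bag x = i" if x: "x \<in> B i" and i: "i < w + 14" for i x
  proof (cases "i \<in> {0, 1, 2, 3, 5}")
    case True
    then show ?thesis using x by (elim insertE emptyE; simp add: B_def; elim disjE; simp add: bag_def)
  next
    case False
    then have "i \<noteq> 0" "i \<noteq> 1" "i \<noteq> 2" "i \<noteq> 3" "i \<noteq> 5" and "x = i \<or> x + i = 2 * w + 32"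
      using x i by (auto simp: B_def)
    from this(6) show ?thesis
    proof
      assume "x = i"
      moreover have "i \<noteq> w + 16" "i \<noteq> 2 * w + 32" "i \<noteq> w + 17" "i \<noteq> 2 * w + 30" "i \<noteq> w + 15" "i \<noteq> 2 * w + 31"
        "i \<noteq> w + 18" "i \<noteq> 2 * w + 27" "i \<noteq> w + 14" "i \<noteq> 2 * w + 29"
        using i by linarith+
      ultimately show ?thesis using False i by (simp add: bag_def)
    next
      assume xi: "x + i = 2 * w + 32"
      have "x \<noteq> 2 * w + 32" "x \<noteq> 2 * w + 30" "x \<noteq> 2 * w + 31" "x \<noteq> 2 * w + 27" "x \<noteq> 2 * w + 29"
        using False xi by auto
      moreover have "x > w + 18" using xi i by linarith
      moreover have "2 * w + 32 - x = i" using xi by linarith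
      ultimately show ?thesis by (simp add: bag_def)
    qed
  qed
  have disj: "B i \<inter> B j = {}" if "i \<in> I" "j \<in> I" "i \<noteq> j" for i j
    using bag that unfolding I_def by (metis disjoint_iff lessThan_iff)
  have cover: "\<exists>i\<in>I. x \<in> B i" if "x \<in> {1..2 * w + 32}" for x
  proof -
    \<comment> \<open>The index of the pair \<open>{i, 2 * u - i}\<close> that contains
      \<open>x\<close>; \<open>i = u\<close> is the unpaired label.\<close>
    define i where "i = min x (2 * w + 32 - x)"
    have x: "x = i \<or> x = 2 * w + 32 - i" "i \<le> w + 16" using that by (auto simp: i_def)
    consider "i \<in> {0, w + 16}" | "i \<in> {1, 2, 3, 5}" | "i = w + 15" | "i = w + 14"
      | "i \<notin> {0, 1, 2, 3, 5}" "i < w + 14" using x(2) by force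
    then show ?thesis
    proof cases
      case 1
      then have "x \<in> B 0" using x that by (auto simp: B_def)
      then show ?thesis using u by (auto simp: I_def)
    next
      case 2
      then have "x \<in> B 1 \<or> x \<in> B 2 \<or> x \<in> B 3 \<or> x \<in> B 5"
        using x(1) by (elim insertE emptyE; simp add: B_def) auto
      then show ?thesis using u by (auto simp: I_def)
    next
      case 3
      then have "x \<in> B 1 \<or> x \<in> B 2" using x u by (auto simp: B_def)
      then show ?thesis using u by (auto simp: I_def)
    next
      case 4
      then have "x \<in> B 3 \<or> x \<in> B 5" using x u by (auto simp: B_def)
      then show ?thesis using u by (auto simp: I_def)
    next
      case 5
      then show ?thesis using x by (auto simp: I_def B_def)
    qed
  qed
  have sumB: "\<Sum>(B i) = (if i \<in> {0, 1, 2, 3, 5} then 3 * u else 2 * u)" if "i \<in> I" for i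
    using that by (auto simp: B_def I_def w)
  show ?thesis
  proof (rule magic_blow_up[of _ I B "2 * w + 32" R])
    show "disjoint_family_on B I"
      using disj by (auto simp: disjoint_family_on_def)
    show "(\<Union>i\<in>I. B i) = {1..2 * w + 32}"
    proof (intro equalityI subsetI)
      fix x assume "x \<in> {1..2 * w + 32}"
      then show "x \<in> (\<Union>i\<in>I. B i)" using cover by blast
    qed (use u in \<open>auto simp: B_def I_def split: if_splits\<close>)
    show "R j i" if "i \<in> I" "j \<in> I" "R i j" for i j
      using that R'(1) by (auto simp: R_def I_def)
    show "\<not> R i i" if "i \<in> I" for i
      using that R'(2) by (auto simp: R_def I_def E_def)
    show "(\<Sum>i | i \<in> I \<and> R i j. \<Sum>(B i)) = 8 * u" if j: "j \<in> I" for j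
    proof (cases "j < 9")
      case True
      \<comment> \<open>No edge joins the gadget to the rest, so nine finite computations
        remain.\<close>
      have "{i. i \<in> I \<and> R i j} = {i \<in> {0, 1, 2, 3, 4, 5, 6, 7, 8}. (i, j) \<in> E \<or> (j, i) \<in> E}"
        using True u E9 by (fastforce simp: R_def I_def)
      then have "(\<Sum>i | i \<in> I \<and> R i j. \<Sum>(B i)) =
          (\<Sum>i\<in>{0, 1, 2, 3, 4, 5, 6, 7, 8}. if (i, j) \<in> E \<or> (j, i) \<in> E then \<Sum>(B i) else 0)"
        by (simp only: sum.inter_filter finite.intros)
      also have "\<dots> = (\<Sum>i\<in>{0, 1, 2, 3, 4, 5, 6, 7, 8}. if (i, j) \<in> E \<or> (j, i) \<in> E
          then if i \<in> {0, 1, 2, 3, 5} then 3 * u else 2 * u else 0)"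
        using u by (intro sum.cong refl if_cong sumB) (auto simp: I_def)
      also have "\<dots> = 8 * u"
      proof -
        have "j \<in> {0, 1, 2, 3, 4, 5, 6, 7, 8}" using True by auto
        then show ?thesis by (elim insertE emptyE; simp add: E_def)
      qed
      finally show ?thesis .
    next
      case False
      then have "{i. i \<in> I \<and> R i j} = {i \<in> {9..<w + 14}. R' i j}"
        by (auto simp: R_def I_def dest: E9)
      moreover have "\<Sum>(B i) = 2 * u" if "i \<in> {9..<w + 14}" for i
        using that sumB[of i] by (simp add: I_def)
      ultimately show ?thesis using R'(3)[of j] False j by (simp add: I_def)
    qed
  qed (use u in \<open>auto simp: I_def lessThan_empty_iff\<close>)
qed

section \<open>Small constants\<close>

text \<open>
  The entry of \<open>C\<close> at position \<open>i\<close> consists of the labels in the bag \<open>i\<close> and of the indices of the bags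
  adjacent to it.
\<close>
definition blow_up_certificate :: "nat \<Rightarrow> (nat list \<times> nat list) list \<Rightarrow> bool" where
  "blow_up_certificate k C \<longleftrightarrow> (let bags = map fst C; nbrs = map snd C; m = length C in
     C \<noteq> [] \<and> sort (concat bags) = [1..<Suc (length (concat bags))] \<and>
     list_all (\<lambda>i. distinct (nbrs ! i) \<and> i \<notin> set (nbrs ! i) \<and>
       list_all (\<lambda>j. j < m \<and> i \<in> set (nbrs ! j)) (nbrs ! i) \<and>
       sum_list (map (\<lambda>j. sum_list (bags ! j)) (nbrs ! i)) = k) [0..<m])"

lemma distinct_concat_disjoint:
  "distinct (concat xs) \<Longrightarrow> disjoint_family_on (\<lambda>i. set (xs ! i)) {..<length xs}"
proof (induction xs)
  case (Cons x xs)
  then have "set (xs ! i) \<inter> set (xs ! j) = {}" if "i < length xs" "j < length xs" "i \<noteq> j" for i j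
    using that by (auto simp: disjoint_family_on_def)
  moreover have "set x \<inter> set (xs ! i) = {}" if "i < length xs" for i
    using Cons.prems that by (auto simp: disjoint_iff)
  ultimately show ?case
    by (auto simp: disjoint_family_on_def less_Suc_eq_0_disj) blast+
qed (simp add: disjoint_family_on_def)

text \<open>That the concatenated bags sort to \<open>1, ..., n\<close> yields disjointness and
  covering at once; the other hypotheses of \<open>magic_blow_up\<close> are checked bag by
  bag.\<close>

lemma magic_certificate:
  assumes cert: "blow_up_certificate k C" and k: "0 < k"
  shows "magic_constant k"
proof -
  define bags where "bags = map fst C"
  define nbrs where "nbrs = map snd C"
  define m where "m = length C"
  define n where "n = length (concat bags)"
  have sort: "sort (concat bags) = [1..<Suc n]" and m: "m \<noteq> 0"
    and all: "list_all (\<lambda>i. distinct (nbrs ! i) \<and> i \<notin> set (nbrs ! i) \<and>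
       list_all (\<lambda>j. j < m \<and> i \<in> set (nbrs ! j)) (nbrs ! i) \<and>
       sum_list (map (\<lambda>j. sum_list (bags ! j)) (nbrs ! i)) = k) [0..<m]"
    using cert unfolding blow_up_certificate_def Let_def bags_def nbrs_def m_def n_def by simp_all
  have "distinct (nbrs ! i) \<and> i \<notin> set (nbrs ! i) \<and>
       list_all (\<lambda>j. j < m \<and> i \<in> set (nbrs ! j)) (nbrs ! i) \<and>
       sum_list (map (\<lambda>j. sum_list (bags ! j)) (nbrs ! i)) = k" if "i < m" for i
    using bspec[OF all[unfolded list_all_iff[of _ "[0..<m]"]], of i] that by simp
  then have nb: "\<And>i. i < m \<Longrightarrow> distinct (nbrs ! i)" "\<And>i. i < m \<Longrightarrow> i \<notin> set (nbrs ! i)"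
      "\<And>i j. i < m \<Longrightarrow> j \<in> set (nbrs ! i) \<Longrightarrow> j < m \<and> i \<in> set (nbrs ! j)"
      "\<And>i. i < m \<Longrightarrow> sum_list (map (\<lambda>j. sum_list (bags ! j)) (nbrs ! i)) = k"
    unfolding list_all_iff by blast+
  have len: "length bags = m" by (simp add: bags_def m_def)
  have dist: "distinct (concat bags)" using distinct_sort[of "\<lambda>x. x" "concat bags"] unfolding sort by (simp del: upt_Suc)
  have set: "set (concat bags) = {1..n}" using set_sort[of "\<lambda>x. x" "concat bags"] unfolding sort by auto
  have sum_bag: "\<Sum>(set (bags ! i)) = sum_list (bags ! i)" if "i < m" for i
  proof -
    have "distinct (bags ! i)" using dist that len by (auto simp: distinct_concat_iff)
    then show ?thesis using sum_list_distinct_conv_sum_set[of "bags ! i" "\<lambda>x. x"] by simp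
  qed
  show ?thesis
  proof (rule magic_blow_up[OF k, of "{..<m}" "\<lambda>i. set (bags ! i)" n "\<lambda>i j. i \<in> set (nbrs ! j)"])
    show "{..<m} \<noteq> {}" using m by (simp add: lessThan_empty_iff)
    show "disjoint_family_on (\<lambda>i. set (bags ! i)) {..<m}"
      using distinct_concat_disjoint[OF dist] len by simp
    show "(\<Union>i\<in>{..<m}. set (bags ! i)) = {1..n}"
    proof -
      have "set bags = (!) bags ` {..<m}" by (auto simp: set_conv_nth len)
      then show ?thesis using set by simp
    qed
    show "(\<Sum>i | i \<in> {..<m} \<and> i \<in> set (nbrs ! j). \<Sum>(set (bags ! i))) = k" if "j \<in> {..<m}" for j
    proof -
      have "{i. i \<in> {..<m} \<and> i \<in> set (nbrs ! j)} = set (nbrs ! j)" using nb(3)[of j] that by blast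
      moreover have "(\<Sum>i\<in>set (nbrs ! j). \<Sum>(set (bags ! i))) = (\<Sum>i\<in>set (nbrs ! j). sum_list (bags ! i))"
        using nb(3)[of j] that by (intro sum.cong refl sum_bag) blast
      ultimately show ?thesis using nb(1,4) that by (simp add: sum_list_distinct_conv_sum_set)
    qed
    show "j \<in> set (nbrs ! i)" if "i \<in> {..<m}" "j \<in> {..<m}" "i \<in> set (nbrs ! j)" for i j
      using nb(3) that by blast
    show "i \<notin> set (nbrs ! i)" if "i \<in> {..<m}" for i using nb(2) that by simp
  qed simp
qed

text \<open>For \<open>4 * 5\<close> and \<open>4 * 7\<close> there are too few pairs for degree 4
  in \<open>magic_even_times_odd\<close>; the multiples of 8 from 24 to 120 lie below the range of
  \<open>magic_eight_times\<close>.\<close>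

lemma magic_20: "magic_constant 20"
  by (rule magic_certificate[where C = "[([15, 5], [1]), ([14, 6], [0]), ([13, 4, 3], [3]), ([12, 8], [2]), ([11, 7, 2], [5]),
      ([10, 9, 1], [4])]"])
    (code_simp, simp)

lemma magic_24: "magic_constant 24"
  by (rule magic_certificate[where C = "[([8, 4], [1, 2]), ([7, 3, 2], [0, 2]), ([6, 5, 1], [0, 1])]"])
    (code_simp, simp)

lemma magic_28: "magic_constant 28"
  by (rule magic_certificate[where C = "[([20, 8], [1]), ([16, 7, 5], [0]), ([14], [3, 4]), ([13, 1], [2, 4]), ([12, 2], [2, 3]),
      ([19, 9], [6]), ([18, 6, 4], [5]), ([17, 11], [8]), ([15, 10, 3], [7])]"])
    (code_simp, simp)

lemma magic_32: "magic_constant 32"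
  by (rule magic_certificate[where C = "[([8], [1, 2]), ([6, 2], [0, 2]), ([14, 10], [0, 1, 3, 4]), ([7, 1], [2, 4]),
      ([5, 3], [2, 3]), ([15, 13, 4], [6]), ([12, 11, 9], [5])]"])
    (code_simp, simp)

lemma magic_40: "magic_constant 40"
  by (rule magic_certificate[where C = "[([15, 5], [1, 2]), ([13, 4, 3], [0, 3]), ([12, 8], [0, 4]), ([14, 6], [1, 5]),
      ([11, 7, 2], [2, 5]), ([10, 9, 1], [3, 4])]"])
    (code_simp, simp)

lemma magic_48: "magic_constant 48"
  by (rule magic_certificate[where C = "[([15, 8, 1], [1, 2]), ([14, 6, 4], [0, 3]), ([12, 7, 5], [0, 4]), ([13, 9, 2], [1, 4]),
      ([11, 10, 3], [2, 3])]"])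
    (code_simp, simp)

text \<open>The same graph serves 64 and 112, with bag sums k/2, k/2, k/8, k/8, k/4, k/4,
  k/8.\<close>

lemma magic_56: "magic_constant 56"
  by (rule magic_certificate[where C = "[([13, 12, 3], [1, 2, 3, 4]), ([11, 9, 8], [0, 3, 5, 6]), ([6, 1], [0, 4, 5]),
      ([5, 2], [0, 1]), ([10, 4], [0, 2, 5, 6]), ([14], [1, 2, 4, 6]), ([7], [1, 4, 5])]"])
    (code_simp, simp)

lemma magic_64: "magic_constant 64"
  by (rule magic_certificate[where C = "[([15, 14, 3], [1, 2, 3, 4]), ([13, 10, 9], [0, 3, 5, 6]), ([7, 1], [0, 4, 5]),
      ([6, 2], [0, 1]), ([11, 5], [0, 2, 5, 6]), ([12, 4], [1, 2, 4, 6]), ([8], [1, 4, 5])]"])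
    (code_simp, simp)

text \<open>A wheel whose hub has sum 48 and whose six rim bags have sum 12.\<close>

lemma magic_72: "magic_constant 72"
  by (rule magic_certificate[where C = "[([15, 14, 13, 6], [1, 2, 3, 4, 5, 6]), ([12], [0, 2, 6]), ([11, 1], [0, 1, 4]),
      ([10, 2], [0, 5, 6]), ([9, 3], [0, 2, 5]), ([8, 4], [0, 3, 4]), ([7, 5], [0, 1, 3])]"])
    (code_simp, simp)

lemma magic_80: "magic_constant 80"
  by (rule magic_certificate[where C = "[([15, 10, 9, 5, 1], [1, 2]), ([14, 11, 8, 4, 3], [0, 2]), ([13, 12, 7, 6, 2], [0, 1])]"])
    (code_simp, simp)

lemma magic_88: "magic_constant 88"
  by (rule magic_certificate[where C = "[([32, 21, 20, 11, 4], [1]), ([31, 22, 19, 9, 7], [0]), ([30, 23, 18, 12, 3, 2], [3]),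
      ([29, 24, 17, 10, 8], [2]), ([28, 25, 16, 13, 6], [5]), ([27, 26, 15, 14, 5, 1], [4])]"])
    (code_simp, simp)

lemma magic_96: "magic_constant 96"
  by (rule magic_certificate[where C = "[([15, 8, 1], [1, 2, 3, 4]), ([14, 6, 4], [0, 2, 3, 4]), ([13, 9, 2], [0, 1, 3, 4]),
      ([12, 7, 5], [0, 1, 2, 4]), ([11, 10, 3], [0, 1, 2, 3])]"])
    (code_simp, simp)

lemma magic_104: "magic_constant 104"
  by (rule magic_certificate[where C = "[([25, 17, 10], [1, 2, 3]), ([24, 18, 9, 1], [0, 2, 4]), ([21, 16, 2], [0, 1]),
      ([13], [0, 5]), ([8, 5], [1, 5]), ([22, 20, 6, 4], [3, 4, 6]),
      ([26, 23, 19, 7, 3], [5, 7, 8]), ([15, 11], [6, 8]), ([14, 12], [6, 7])]"])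
    (code_simp, simp)

lemma magic_112: "magic_constant 112"
  by (rule magic_certificate[where C = "[([20, 17, 14, 5], [1, 2, 3, 4]), ([19, 18, 12, 7], [0, 3, 5, 6]), ([11, 3], [0, 4, 5]),
      ([8, 6], [0, 1]), ([15, 9, 4], [0, 2, 5, 6]), ([16, 10, 2], [1, 2, 4, 6]),
      ([13, 1], [1, 4, 5])]"])
    (code_simp, simp)

text \<open>Two triangles sharing bag \<open>1\<close>, which has sum 90; the other bags have sum
  30.\<close>

lemma magic_120: "magic_constant 120"
  by (rule magic_certificate[where C = "[([16, 9, 5], [1, 2]), ([20, 19, 18, 17, 11, 4, 1], [0, 2, 3, 4]),
      ([13, 12, 3, 2], [0, 1]), ([15, 8, 7], [1, 4]), ([14, 10, 6], [1, 3])]"])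
    (code_simp, simp)

section \<open>Exhaustive search\<close>

text \<open>
  Decides whether there is a graph on the labels \<open>1, \<dots>, h\<close> with prescribed weights, by deciding the
  edges at \<open>h\<close> first, then those at \<open>h - 1\<close>, and so on. The edges from \<open>h\<close> to the labels above \<open>t\<close>
  have been decided; \<open>r\<close> is the weight that \<open>h\<close> still needs, \<open>xs\<close> lists the remaining weights of
  \<open>t, \<dots>, 1\<close> and \<open>ys\<close> those of \<open>h - 1, \<dots>, t + 1\<close>. A branch is pruned when a remaining weight exceeds
  the sum of the labels still available. Nested conditionals, unlike conjunctions, are evaluated
  lazily by the simplifier.
\<close>
function search :: "int \<Rightarrow> int \<Rightarrow> int \<Rightarrow> int list \<Rightarrow> int list \<Rightarrow> bool" where
  "search h t r [] [] = (r = 0)"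
| "search h t r [] (y # ys) = (if r = 0 then search (h - 1) (h - 2) y ys [] else False)"
| "search h t r (x # xs) ys =
     (if 2 * r > t * (t + 1) then False
      else if 2 * (x + t) > h * (h - 1) + 2 * h then False
      else if (if t \<le> r then if h \<le> x then search h (t - 1) (r - t) xs (ys @ [x - h]) else False else False)
      then True
      else if 2 * (x + t) > h * (h - 1) then False
      else search h (t - 1) r xs (ys @ [x]))"
  by pat_completeness auto
termination
  by (relation "measures [\<lambda>(h, t, r, xs, ys). length xs + length ys, \<lambda>(h, t, r, xs, ys). length xs]") auto

section \<open>Completeness of the search\<close>

definition labels_down :: "int \<Rightarrow> int \<Rightarrow> int list" where
  "labels_down a b = rev [a..b]"

lemma labels_down_eq_Nil_iff [simp]: "labels_down a b = [] \<longleftrightarrow> b < a"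
  by (simp add: labels_down_def)

lemma labels_down_Nil [simp]: "b < a \<Longrightarrow> labels_down a b = []"
  by simp

lemma labels_down_Cons: "a \<le> b \<Longrightarrow> labels_down a b = b # labels_down a (b - 1)"
  unfolding labels_down_def by (subst upto_rec2) simp_all

lemma labels_down_snoc: "a \<le> b \<Longrightarrow> labels_down a b = labels_down (a + 1) b @ [a]"
  unfolding labels_down_def by (subst upto_rec1) simp_all

text \<open>For a solution \<open>E\<close>, what \<open>v\<close> still needs once its edges to
  labels above \<open>m\<close> are decided; \<open>search\<close> stores these values.\<close>

definition partial_weight :: "(int \<Rightarrow> int \<Rightarrow> bool) \<Rightarrow> int \<Rightarrow> int \<Rightarrow> int" where
  "partial_weight E m v = (\<Sum>u\<in>{1..m}. if E u v then u else 0)"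

lemma partial_weight_rec:
  assumes "1 \<le> m"
  shows "partial_weight E m v = (if E m v then m else 0) + partial_weight E (m - 1) v"
proof -
  have "{1..m} = insert m {1..m - 1}" using assms by auto
  then show ?thesis by (simp add: partial_weight_def)
qed

lemma partial_weight_0 [simp]: "partial_weight E 0 v = 0"
  by (simp add: partial_weight_def)

context
  fixes E :: "int \<Rightarrow> int \<Rightarrow> bool"
  assumes sym: "\<And>u v. E u v \<Longrightarrow> E v u" and irrefl: "\<And>v. \<not> E v v"
begin

lemma partial_weight_bound:
  assumes "0 \<le> m"
  shows "0 \<le> partial_weight E m v"
    and "2 * (partial_weight E m v + (if 1 \<le> v \<and> v \<le> m then v else 0)) \<le> m * (m + 1)"
proof -
  show "0 \<le> partial_weight E m v" by (auto simp: partial_weight_def intro!: sum_nonneg)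
  show "2 * (partial_weight E m v + (if 1 \<le> v \<and> v \<le> m then v else 0)) \<le> m * (m + 1)"
    using assms
  proof (induction m rule: int_ge_induct)
    case (step m)
    then show ?case
      using irrefl[of v] partial_weight_rec[of "m + 1" E v]
      by (cases "v = m + 1") (auto simp: algebra_simps split: if_splits)
  qed (simp add: partial_weight_0)
qed

text \<open>The search can follow \<open>E\<close>: its states then store the partial weights of
  \<open>E\<close>, which the bounds never prune.\<close>

lemma search_complete:
  assumes "0 \<le> t" "t < h"
  shows "search h t (partial_weight E t h)
    (map (partial_weight E h) (labels_down 1 t)) (map (partial_weight E (h - 1)) (labels_down (t + 1) (h - 1)))"
proof -
  have "search h t r xs ys"
    if "r = partial_weight E t h" "xs = map (partial_weight E h) (labels_down 1 t)"
      "ys = map (partial_weight E (h - 1)) (labels_down (t + 1) (h - 1))" "0 \<le> t" "t < h" for r xs ys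
    using that
  proof (induction h t r xs ys rule: search.induct)
    case (1 h t r)
    then have "t = 0" by auto
    with 1 show ?case by (simp add: partial_weight_0)
  next
    case (2 h t r y ys)
    then have t: "t = 0" by auto
    with 2 have r: "r = 0" by (simp add: partial_weight_0)
    have "labels_down 1 (h - 1) \<noteq> []" using 2(4) t by (auto simp del: labels_down_eq_Nil_iff)
    then have h: "2 \<le> h" by simp
    then have yy: "y = partial_weight E (h - 1) (h - 1)" "ys = map (partial_weight E (h - 1)) (labels_down 1 (h - 2))"
      using 2(4) t by (auto simp: labels_down_Cons[of 1 "h - 1"])
    \<comment> \<open>Without a loop, the need of \<open>h - 1\<close> is already the value of
      \<open>r\<close> in the next round.\<close>
    have "partial_weight E (h - 1) (h - 1) = partial_weight E (h - 2) (h - 1)"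
      using h irrefl by (simp add: partial_weight_rec[of "h - 1" E])
    then show ?case
      using 2(1)[OF r] yy h r by simp
  next
    case (3 h t r x xs ys)
    have t: "1 \<le> t"
      using 3(4) by (cases "1 \<le> t") auto
    then have x: "x = partial_weight E h t" "xs = map (partial_weight E h) (labels_down 1 (t - 1))"
      using 3(4) by (auto simp: labels_down_Cons[of 1 t])
    have h: "1 \<le> h" and th: "t \<le> h - 1" using t 3(7) by auto
    have r: "r = (if E t h then t else 0) + partial_weight E (t - 1) h"
      using 3(3) partial_weight_rec[OF t] by simp
    have x': "x = (if E t h then h else 0) + partial_weight E (h - 1) t"
      unfolding x partial_weight_rec[OF h] using sym by auto
    have ys: "ys @ [partial_weight E (h - 1) t] = map (partial_weight E (h - 1)) (labels_down (t - 1 + 1) (h - 1))"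
      using 3(5) labels_down_snoc[OF th] by simp
    have b1: "2 * r \<le> t * (t + 1)"
      using partial_weight_bound(2)[of t h] 3(3,6,7) by simp
    have b2: "2 * (partial_weight E (h - 1) t + t) \<le> h * (h - 1)"
      using partial_weight_bound(2)[of "h - 1" t] t th by (simp add: mult.commute)
    have nonneg: "0 \<le> partial_weight E (t - 1) h" "0 \<le> partial_weight E (h - 1) t"
      using partial_weight_bound(1) t h by simp_all
    show ?case
    proof (cases "E t h")
      case True
      then have "search h (t - 1) (r - t) xs (ys @ [x - h])"
        using b1 b2 nonneg r x' t th h ys x(2) by (intro 3(1)) auto
      with True show ?thesis
        using b1 b2 nonneg r x' h by auto
    next
      case False
      \<comment> \<open>The induction hypothesis for omitting the edge assumes that including it
        fails; otherwise the search has already succeeded.\<close>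
      then have "search h (t - 1) r xs (ys @ [x])" if "\<not> (if t \<le> r then if h \<le> x then search h (t - 1) (r - t) xs (ys @ [x - h]) else False else False)"
        using b1 b2 nonneg r x' t th h ys x(2) that by (intro 3(2)) auto
      with False show ?thesis
        using b1 b2 nonneg r x' h by auto
    qed
  qed
  with assms show ?thesis by blast
qed

lemma search_complete_magic:
  assumes "1 \<le> n" "\<And>v. v \<in> {1..n} \<Longrightarrow> partial_weight E n v = k"
  shows "search n (n - 1) k (replicate (nat (n - 1)) k) []"
proof -
  have "partial_weight E (n - 1) n = k"
    using assms partial_weight_rec[of n E n] irrefl by simp
  moreover have "map (partial_weight E n) (labels_down 1 (n - 1)) = replicate (nat (n - 1)) k"
    using assms by (intro replicate_eqI) (auto simp: labels_down_def)
  ultimately show ?thesis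
    using search_complete[of "n - 1" n] assms(1) by simp
qed

end

text \<open>Transport along \<open>f\<close> makes the labels themselves the vertices, leaving one
  search for each order up to \<open>k\<close>.\<close>

lemma magic_constant_search:
  assumes "magic_constant k"
  obtains n where "1 \<le> n" "n \<le> k" "search (int n) (int n - 1) (int k) (replicate (n - 1) (int k)) []"
proof -
  obtain G :: "nat pair_pre_digraph" and f where G: "pair_graph G" "pverts G \<noteq> {}" "magic_labelling G f k"
    and k: "0 < k"
    using assms by (auto simp: magic_constant_def)
  interpret pair_graph G by fact
  define n where "n = card (pverts G)"
  have bij: "bij_betw f (pverts G) {1..n}"
    and wt: "\<And>v. v \<in> pverts G \<Longrightarrow> weight G f v = k"
    using G(3) by (auto simp: magic_labelling_def n_def)
  have inj: "inj_on f (pverts G)" and img: "f ` pverts G = {1..n}"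
    using bij by (auto simp: bij_betw_def)
  have n: "1 \<le> n" using G(2) by (simp add: n_def card_gt_0_iff Suc_le_eq)
  define E where "E u v \<longleftrightarrow> (\<exists>x y. (x, y) \<in> parcs G \<and> u = int (f x) \<and> v = int (f y))" for u v
  have E_iff: "E u (int (f v)) \<longleftrightarrow> u \<in> int ` f ` neighborhood G v" if "v \<in> pverts G" for u v
  proof
    assume "E u (int (f v))"
    then obtain x y where xy: "(x, y) \<in> parcs G" "u = int (f x)" "f v = f y"
      by (auto simp: E_def)
    then have "y = v" using inj_onD[OF inj] that in_arcsD2 by metis
    with xy show "u \<in> int ` f ` neighborhood G v"
      using in_arcsD1 by (auto simp: neighborhood_def)
  qed (auto simp: E_def neighborhood_def)
  have sym: "E v u" if "E u v" for u v
    using that arcs_symmetric by (auto simp: E_def)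
  have irrefl: "\<not> E v v" for v
    using inj by (auto simp: E_def inj_on_def dest: no_loops' in_arcsD1 in_arcsD2)
  have nb: "neighborhood G v \<subseteq> pverts G" for v by (auto simp: neighborhood_def)
  have "partial_weight E (int n) (int (f v)) = int k" if v: "v \<in> pverts G" for v
  proof -
    have "{u \<in> {1..int n}. E u (int (f v))} = (\<lambda>x. int (f x)) ` neighborhood G v"
      using E_iff[OF v] img nb[of v] by (force simp: image_image)
    moreover have "inj_on (\<lambda>x. int (f x)) (neighborhood G v)"
      using inj_on_subset[OF inj nb] by (simp add: inj_on_def)
    ultimately have "(\<Sum>u | u \<in> {1..int n} \<and> E u (int (f v)). u) = int (weight G f v)"
      by (simp add: weight_def sum.reindex)
    then show ?thesis
      using wt[OF v] by (simp add: partial_weight_def flip: sum.inter_filter)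
  qed
  moreover have "\<exists>v\<in>pverts G. u = int (f v)" if "u \<in> {1..int n}" for u
  proof -
    have "nat u \<in> f ` pverts G" using that img by auto
    then obtain x where "x \<in> pverts G" "f x = nat u" by auto
    then show ?thesis using that by (intro bexI[of _ x]) auto
  qed
  ultimately have "search (int n) (int n - 1) (int k) (replicate (nat (int n - 1)) (int k)) []"
    using n by (intro search_complete_magic[where E = E, OF sym irrefl]) auto
  moreover have "nat (int n - 1) = n - 1" by simp
  moreover have "n \<le> k"
  proof -
    obtain x where x: "x \<in> pverts G" "f x = n" using img n by (metis atLeastAtMost_iff image_iff order_refl)
    have "neighborhood G x \<noteq> {}" using wt[OF x(1)] k by (auto simp: weight_def)
    then obtain y where y: "y \<in> pverts G" "(x, y) \<in> parcs G"
      using arcs_symmetric by (auto simp: neighborhood_def)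
    have "finite (neighborhood G y)" using nb finite_subset pair_finite_verts by blast
    moreover have "x \<in> neighborhood G y" using x y by (simp add: neighborhood_def)
    ultimately have "f x \<le> weight G f y" unfolding weight_def by (simp add: member_le_sum)
    then show ?thesis using wt y x by simp
  qed
  ultimately show thesis using n that by simp
qed

section \<open>The exceptional constants\<close>

definition infeasible :: "int \<Rightarrow> int \<Rightarrow> bool" where
  "infeasible k n \<longleftrightarrow> \<not> search n (n - 1) k (replicate (nat (n - 1)) k) []"

lemma infeasible_up_to_8: "k \<in> {1, 2, 4, 6, 8} \<Longrightarrow> list_all (infeasible k) [1..k]"
  by (elim insertE emptyE; hypsubst; code_simp)

lemma infeasible_12: "list_all (infeasible 12) [1..12]"
  by code_simp

lemma infeasible_16_13: "list_all (infeasible 16) [1..13]"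
  by code_simp

lemma infeasible_16_14: "infeasible 16 14"
  by code_simp

lemma infeasible_16_15: "infeasible 16 15"
  by code_simp

lemma infeasible_16_16: "infeasible 16 16"
  by code_simp

lemma infeasible_16: "list_all (infeasible 16) [1..16]"
proof -
  have "[1..16] = [1..13] @ [14, 15, 16 :: int]" by code_simp
  then show ?thesis
    by (simp only: list_all_append list.pred_inject simp_thms infeasible_16_13 infeasible_16_14 infeasible_16_15 infeasible_16_16)
qed

lemma not_magic:
  assumes "k \<in> {1, 2, 4, 6, 8, 12, 16}"
  shows "\<not> magic_constant k"
proof
  assume "magic_constant k"
  then obtain n where n: "1 \<le> n" "n \<le> k"
      "search (int n) (int n - 1) (int k) (replicate (n - 1) (int k)) []"
    by (rule magic_constant_search)
  have "int k \<in> {1, 2, 4, 6, 8} \<or> int k = 12 \<or> int k = 16" using assms by auto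
  then have "list_all (infeasible (int k)) [1..int k]"
    by (elim disjE) (simp_all only: infeasible_up_to_8 infeasible_12 infeasible_16)
  moreover have "int n \<in> set [1..int k]" using n by simp
  ultimately have "infeasible (int k) (int n)"
    unfolding list_all_iff by blast
  moreover have "nat (int n - 1) = n - 1" by simp
  ultimately show False using n(3) by (simp add: infeasible_def)
qed

theorem theorem4p1:
  fixes k :: nat
  assumes "0 < k"
  shows "magic_constant k \<longleftrightarrow> k \<notin> {1, 2, 4, 6, 8, 12, 16}"
proof
  show "k \<notin> {1, 2, 4, 6, 8, 12, 16}" if "magic_constant k" using that not_magic by blast
next
  assume k: "k \<notin> {1, 2, 4, 6, 8, 12, 16}"
  \<comment> \<open>The cases follow the power of two dividing \<open>k\<close>.\<close>
  consider (odd) "odd k" | (two) m where "k = 2 * m" "odd m" | (four) q where "k = 4 * q" "odd q"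
    | (eight) u where "k = 8 * u"
  proof -
    have "odd k \<or> (\<exists>m. k = 2 * m \<and> odd m) \<or> (\<exists>q. k = 4 * q \<and> odd q) \<or> (\<exists>u. k = 8 * u)"
      by presburger
    then show thesis using that by blast
  qed
  then show "magic_constant k"
  proof cases
    case odd
    then have "k \<noteq> 0" "k \<noteq> 1" "k \<noteq> 2" using k assms by auto
    with odd show ?thesis by (intro magic_odd) auto
  next
    case two
    then have "m \<noteq> 1" "m \<noteq> 3" using k by auto
    with \<open>odd m\<close> have "5 \<le> m" by presburger
    with two show ?thesis using magic_even_times_odd[of 1 m] by simp
  next
    case four
    then have "q \<noteq> 1" "q \<noteq> 3" using k by auto
    \<comment> \<open>Degree 4 requires \<open>q \<ge> 9\<close>; the values 5 and 7 have
      certificates.\<close>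
    with \<open>odd q\<close> have "q = 5 \<or> q = 7 \<or> 9 \<le> q" by presburger
    with four show ?thesis
      using magic_even_times_odd[of 2 q] magic_20 magic_28 by auto
  next
    case eight
    then have "u \<noteq> 0" "u \<noteq> 1" "u \<noteq> 2" using k assms by auto
    then have "u \<in> {3, 4, 5, 6, 7, 8, 9, 10, 11, 12, 13, 14, 15}" if "u < 16"
      using that by (simp, presburger)
    then consider "16 \<le> u" | "u \<in> {3, 4, 5, 6, 7, 8, 9, 10, 11, 12, 13, 14, 15}"
      by (meson not_le)
    then show ?thesis
    proof cases
      case 1
      then show ?thesis using magic_eight_times eight by simp
    next
      case 2
      then show ?thesis
        unfolding eight
        by (elim insertE emptyE) (simp_all add: magic_24 magic_32 magic_40 magic_48 magic_56 magic_64 magic_72 magic_80 magic_88 magic_96 magic_104 magic_112 magic_120)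
    qed
  qed
qed

end
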